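(* There is an uncountable set $C$ of real numbers and a function $\psi:\mathbb{Z}_{\geq1}\to[0,\infty)$ such that $\sum_{n\geq1}\psi(n)$ diverges and such that for every $y\in C$, the set of real numbers $x$ for which the inequality $\|nx+y\|<\psi(n)$ is satisfied by infinitely many integers $n\geq1$ has Lebesgue measure zero.
   Context: For a real number $t$, $\|t\|$ denotes the distance from $t$ to the nearest integer. *)

theory Defs
  imports "HOL-Analysis.Analysis"
begin

definition dist_nearest_int :: "real \<Rightarrow> real" where
  "dist_nearest_int t = infdist t \<int>"

end

theory Submission
  imports Defs
begin

text \<open>
  The Duffin--Schaeffer counterexample survives a simultaneous perturbation by Liouville numbers.
  If \<open>y\<close> is extremely close to \<open>p/q\<close> and \<open>n\<close> divides \<open>N\<close>, every \<open>x\<close> with \<open>\<parallel>n x + y\<parallel> < n r\<close> is within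
  slightly more than \<open>r\<close> of a fraction with denominator \<open>q N\<close>. For \<open>r = \<epsilon> / (q N)\<close> these fractions have
  neighbourhoods of density about \<open>2 \<epsilon>\<close>, whereas the sum of \<open>n r\<close> over the divisors \<open>n\<close> of \<open>N\<close> is
  \<open>(\<epsilon> / q) (\<Sum>d | d dvd N. 1 / d)\<close>, which is as large as we like for \<open>N\<close> a large factorial. Iterate with
  \<open>\<epsilon> = 2\<^sup>-\<^sup>j\<close> and rapidly growing \<open>q\<^sub>j\<close>, each dividing the next; the Cantor set of all sums of
  \<open>1 / q\<^sub>k\<close> over \<open>k \<in> S\<close>, with \<open>S\<close> a set of naturals, has the required approximations with the
  same denominators for all its elements.
\<close>

section \<open>Neighbourhoods of the fractions with a fixed denominator\<close>

lemma dist_nearest_int_less_iff: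
  "dist_nearest_int t < e \<longleftrightarrow> (\<exists>a::int. \<bar>t - of_int a\<bar> < e)"
proof -
  have "dist_nearest_int t = (INF a\<in>\<int>. dist t a)"
    unfolding dist_nearest_int_def by (rule infdist_notempty) auto
  moreover have "bdd_below (dist t ` \<int>)"
    by (rule bdd_belowI[of _ 0]) auto
  ultimately show ?thesis
    by (auto simp: cINF_less_iff dist_real_def Ints_def)
qed

text \<open>The radius around each fraction is \<open>e / K\<close>, so for 0 \<le> \<open>e\<close>
  \<le> 1/2 the density is \<open>2 * e\<close> whatever \<open>K\<close> is.\<close>

definition near_fractions :: "nat \<Rightarrow> real \<Rightarrow> real set" where
  "near_fractions K e = {x. dist_nearest_int (real K * x) < e}"

lemma near_fractions_eq:
  assumes "K > 0"
  shows "near_fractions K e = (\<Union>a::int. ball (of_int a / real K) (e / real K))"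
proof -
  have "\<bar>real K * x - of_int a\<bar> < e \<longleftrightarrow> x \<in> ball (of_int a / real K) (e / real K)" for x a
  proof -
    have "real K * x - of_int a = real K * (x - of_int a / real K)"
      using assms by (simp add: field_simps)
    then have "\<bar>real K * x - of_int a\<bar> = real K * \<bar>x - of_int a / real K\<bar>"
      by (simp add: abs_mult)
    then show ?thesis
      using assms by (simp add: dist_real_def abs_minus_commute field_simps)
  qed
  then show ?thesis
    by (auto simp: near_fractions_def dist_nearest_int_less_iff)
qed

lemma near_fractions_measurable:
  assumes "K > 0"
  shows "near_fractions K e \<in> sets lebesgue"
proof -
  have "open (near_fractions K e)"
    unfolding near_fractions_eq[OF assms] by auto
  then show ?thesis by auto
qed

text \<open>Only about \<open>2 * K * m\<close> numerators are relevant, each with an interval of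
  length \<open>2 * e / K\<close>. The factor \<open>K\<close> cancels, so the bound depends on the
  window and \<open>e\<close> alone.\<close>

lemma measure_near_fractions_Int_le:
  assumes K: "K > 0" and e: "0 \<le> e" "e \<le> 1"
  shows "measure lebesgue (near_fractions K e \<inter> {- real m..real m}) \<le> (4 * real m + 6) * e"
proof -
  define A where "A = {- int (K * m + 1)..int (K * m + 1)}"
  define B where "B = (\<Union>a\<in>A. ball (of_int a / real K) (e / real K))"
  have "near_fractions K e \<inter> {- real m..real m} \<subseteq> B"
  proof
    fix x assume x: "x \<in> near_fractions K e \<inter> {- real m..real m}"
    then obtain a :: int where a: "x \<in> ball (of_int a / real K) (e / real K)"
      by (auto simp: near_fractions_eq[OF K])
    then have "\<bar>of_int a / real K - x\<bar> < e / real K"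
      by (simp add: dist_real_def)
    then have "real K * \<bar>of_int a / real K - x\<bar> < e"
      using K by (simp add: field_simps)
    moreover have "of_int a - real K * x = real K * (of_int a / real K - x)"
      using K by (simp add: field_simps)
    ultimately have "\<bar>of_int a - real K * x\<bar> < 1"
      using e by (simp add: abs_mult)
    moreover have "\<bar>real K * x\<bar> \<le> real K * real m"
      using x by (simp add: abs_mult mult_left_mono abs_le_iff)
    ultimately have "\<bar>real_of_int a\<bar> \<le> of_int (int (K * m + 1))"
      by simp
    then have "\<bar>a\<bar> \<le> int (K * m + 1)"
      by (simp only: of_int_abs[symmetric] of_int_le_iff)
    then have "a \<in> A"
      unfolding A_def by auto
    with a show "x \<in> B" by (auto simp: B_def)
  qed
  moreover have "B \<in> lmeasurable"
    unfolding B_def A_def by (intro fmeasurable.finite_UN) auto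
  ultimately have "measure lebesgue (near_fractions K e \<inter> {- real m..real m}) \<le> measure lebesgue B"
    by (intro measure_mono_fmeasurable sets.Int near_fractions_measurable K) auto
  also have "\<dots> \<le> (\<Sum>a\<in>A. measure lebesgue (ball (of_int a / real K) (e / real K)))"
    unfolding B_def A_def by (intro measure_UNION_le) auto
  also have "\<dots> = real (card A) * (2 * (e / real K))"
    using e by (simp add: ball_eq_greaterThanLessThan)
  also have "real (card A) = 2 * real K * real m + 3"
    unfolding A_def by simp
  also have "(2 * real K * real m + 3) * (2 * (e / real K)) = 4 * real m * e + 6 * (e / real K)"
    using K by (simp add: field_simps)
  also have "\<dots> \<le> 4 * real m * e + 6 * e"
  proof -
    have "e / real K \<le> e / 1"
      using K e by (intro divide_left_mono) auto
    then show ?thesis by simp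
  qed
  finally show ?thesis by (simp add: algebra_simps)
qed

text \<open>Borel-Cantelli needs sets of finite measure, so it is applied inside each window from
  \<open>-m\<close> to \<open>m\<close>; the limsup is the countable union over the windows.\<close>

lemma null_sets_limsup_near_fractions:
  assumes K: "\<And>j. K j > 0" and e: "\<And>j. 0 \<le> e j" "\<And>j. e j \<le> 1" "summable e"
  shows "limsup (\<lambda>j. near_fractions (K j) (e j)) \<in> null_sets lebesgue"
proof -
  define E where "E m j = near_fractions (K j) (e j) \<inter> {- real m..real m}" for m j
  have "limsup (E m) \<in> null_sets lebesgue" for m
  proof (rule borel_cantelli_limsup1)
    show meas: "E m j \<in> sets lebesgue" for j
      unfolding E_def by (intro sets.Int near_fractions_measurable K) auto
    have "emeasure lebesgue (E m j) \<le> emeasure lebesgue {- real m..real m}" for j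
      unfolding E_def by (intro emeasure_mono) auto
    then show "emeasure lebesgue (E m j) < \<infinity>" for j
      by (rule le_less_trans) simp
    show "summable (\<lambda>j. measure lebesgue (E m j))"
    proof (rule summable_comparison_test')
      show "summable (\<lambda>j. (4 * real m + 6) * e j)"
        by (intro summable_mult e)
      show "norm (measure lebesgue (E m j)) \<le> (4 * real m + 6) * e j" for j
        unfolding E_def using measure_near_fractions_Int_le[OF K e(1,2)] by simp
    qed
  qed
  moreover have "limsup (\<lambda>j. near_fractions (K j) (e j)) = (\<Union>m. limsup (E m))"
  proof -
    have "\<exists>m. - real m \<le> x \<and> x \<le> real m" for x
      using real_arch_simple[of "\<bar>x\<bar>"] by (metis abs_le_iff minus_le_iff)
    then show ?thesis
      by (simp add: limsup_INF_SUP E_def set_eq_iff)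
  qed
  ultimately show ?thesis by auto
qed

text \<open>With \<open>N = n * c\<close>, replace \<open>y\<close> by \<open>p / q\<close> and
  multiply by \<open>q * c\<close>: \<open>n * x + y\<close> close to \<open>a\<close> becomes
  \<open>q * N * x\<close> close to the integer \<open>c * (q * a - p)\<close>. One pair of radius
  and denominator thus serves all divisors \<open>n\<close> of \<open>N\<close>.\<close>

lemma mem_near_fractions_if_approx:
  assumes n: "n dvd N" "N > 0" and q: "q > 0"
    and y: "\<bar>y - of_int p / real q\<bar> \<le> \<delta>"
    and x: "dist_nearest_int (real n * x + y) < real n * r"
    and e: "real (q * N) * (r + \<delta>) \<le> e"
  shows "x \<in> near_fractions (q * N) e"
proof -
  obtain c where c: "N = n * c" using n by auto
  have n0: "n > 0" and c0: "c > 0" using n c by (auto intro: Nat.gr0I)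
  have d0: "\<delta> \<ge> 0" using y by linarith
  obtain a :: int where a: "\<bar>real n * x + y - of_int a\<bar> < real n * r"
    using x by (auto simp: dist_nearest_int_less_iff)
  define b where "b = int c * (int q * a - p)"
  have "real (q * N) * x - of_int b
      = real (q * c) * ((real n * x + y - of_int a) - (y - of_int p / real q))"
    using q by (simp add: b_def c field_simps)
  then have "\<bar>real (q * N) * x - of_int b\<bar>
      = real (q * c) * \<bar>(real n * x + y - of_int a) - (y - of_int p / real q)\<bar>"
    by (simp add: abs_mult)
  also have "\<dots> < real (q * c) * (real n * r + \<delta>)"
    using a y q c0 by (intro mult_strict_left_mono) auto
  \<comment> \<open>Inflating \<delta> by \<open>n\<close> \<ge> 1 lets \<open>c * n\<close> combine
    to \<open>N\<close>, which removes \<open>n\<close> from the bound.\<close>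
  also have "\<dots> \<le> real (q * c) * (real n * r + real n * \<delta>)"
    using d0 n0 mult_right_mono[of 1 "real n" \<delta>] by (intro mult_left_mono add_left_mono) auto
  also have "\<dots> = real (q * N) * (r + \<delta>)"
    by (simp add: c algebra_simps)
  finally show ?thesis
    using e unfolding near_fractions_def dist_nearest_int_less_iff mem_Collect_eq
    by (intro exI[of _ b]) linarith
qed

section \<open>Divisor sums of factorials\<close>

text \<open>The complementary divisors \<open>fact M div d\<close>, for \<open>d\<close> from 1 to
  \<open>M\<close>, are distinct, and they alone add up to the left factor times the harmonic
  number.\<close>

lemma sum_divisors_fact_ge: "real (\<Sum>{n. n dvd (fact M :: nat)}) \<ge> fact M * harm M"
proof -
  let ?N = "fact M :: nat"
  have dvd: "d dvd ?N" if "d \<in> {1..M}" for d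
    using that by (intro dvd_fact) auto
  have inj: "inj_on (\<lambda>d. ?N div d) {1..M}"
  proof (rule inj_onI)
    fix c d assume cd: "c \<in> {1..M}" "d \<in> {1..M}" "?N div c = ?N div d"
    then have "(?N div d) * c = (?N div d) * d"
      using dvd[of c] dvd[of d] by (metis dvd_div_mult_self)
    moreover have "?N div d \<noteq> 0"
      using dvd[OF cd(2)] by (simp add: dvd_div_eq_0_iff)
    ultimately show "c = d" by simp
  qed
  have "fact M * harm M = (\<Sum>d\<in>{1..M}. real ?N / real d)"
    by (simp add: harm_def sum_distrib_left divide_inverse)
  also have "\<dots> = (\<Sum>d\<in>{1..M}. real (?N div d))"
    using dvd by (intro sum.cong) (auto simp: real_of_nat_div)
  also have "\<dots> = real (\<Sum>((\<lambda>d. ?N div d) ` {1..M}))"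
    by (simp only: of_nat_sum sum.reindex[OF inj] o_def)
  also have "\<dots> \<le> real (\<Sum>{n. n dvd ?N})"
    using dvd by (intro of_nat_mono sum_mono2) (auto intro: div_dvd_iff_mult[THEN iffD2])
  finally show ?thesis .
qed

text \<open>Comparison with the logarithm; base 4 suffices because 4 exceeds Euler's number, so
  \<open>ln 4\<close> \<ge> 1.\<close>

lemma harm_power_4_ge: "harm (4 ^ k) \<ge> real k"
proof -
  have "real k * 1 \<le> real k * ln 4"
    using exp_le by (intro mult_left_mono) (auto simp: ln_ge_iff)
  also have "\<dots> = ln (4 ^ k)" by (simp add: ln_realpow)
  also have "\<dots> \<le> ln (real (Suc (4 ^ k)))" by (intro ln_mono) auto
  also have "\<dots> \<le> harm (4 ^ k)" using ln_le_harm[of "4 ^ k"] by (simp add: add_ac)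
  finally show ?thesis by simp
qed

section \<open>The Cantor set of lacunary reciprocal sums\<close>

text \<open>Sets of naturals act as 0-1 digit sequences, so uncountability can come straight from
  Cantor's theorem.\<close>

definition reciprocal_sum :: "(nat \<Rightarrow> nat) \<Rightarrow> nat set \<Rightarrow> real" where
  "reciprocal_sum q S = (\<Sum>k. if k \<in> S then 1 / real (q k) else 0)"

context
  fixes q :: "nat \<Rightarrow> nat"
  assumes pos: "\<And>k. q k > 0" and growth: "\<And>k. 8 * q k \<le> q (Suc k)"
begin

lemma lacunary_reciprocal_le: "1 / real (q (i + j)) \<le> (1 / 8) ^ i / real (q j)"
proof (induction i)
  case (Suc i)
  have "8 * real (q (i + j)) \<le> real (q (Suc i + j))"
    using growth[of "i + j"] by simp
  then have "1 / real (q (Suc i + j)) \<le> 1 / (8 * real (q (i + j)))"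
    using pos by (intro divide_left_mono) auto
  also have "\<dots> = (1 / 8) * (1 / real (q (i + j)))" by simp
  also have "\<dots> \<le> (1 / 8) * ((1 / 8) ^ i / real (q j))"
    using Suc by (intro mult_left_mono) auto
  finally show ?case by simp
qed simp

text \<open>The tail from index \<open>j\<close> is dominated by a geometric series of ratio 1/8,
  with sum \<open>(8/7) / q j\<close>, rounded up to \<open>2 / q j\<close>.\<close>

lemma reciprocal_sum_bounds:
  fixes S :: "nat set" and j :: nat
  defines "head \<equiv> \<lambda>S j. \<Sum>k<j. if k \<in> S then 1 / real (q k) else 0"
  shows "head S j \<le> reciprocal_sum q S" "reciprocal_sum q S \<le> head S j + 2 / real (q j)"
proof -
  define f where "f k = (if k \<in> S then 1 / real (q k) else 0)" for k
  have f0: "f k \<ge> 0" for k by (simp add: f_def)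
  have fle: "f (i + j) \<le> (1 / 8) ^ i / real (q j)" for i j
    using lacunary_reciprocal_le[of i j] by (simp add: f_def)
  have geo: "(\<lambda>i. (1 / 8) ^ i / real (q j)) sums ((8 / 7) / real (q j))" for j
    using geometric_sums[of "1 / 8 :: real"] by (intro sums_divide) simp
  have summ: "summable (\<lambda>i. f (i + j))" for j
    by (rule summable_comparison_test'[OF sums_summable[OF geo]]) (use f0 fle in auto)
  have split: "reciprocal_sum q S = (\<Sum>i. f (i + j)) + head S j"
    using suminf_split_initial_segment[of f j] summ[of 0]
    unfolding reciprocal_sum_def head_def f_def[symmetric] by simp
  show "head S j \<le> reciprocal_sum q S"
    using split suminf_nonneg[OF summ f0] by simp
  have "(\<Sum>i. f (i + j)) \<le> (8 / 7) / real (q j)"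
    using suminf_le[OF fle summ sums_summable[OF geo]] sums_unique[OF geo] by simp
  also have "\<dots> \<le> 2 / real (q j)"
    by (intro divide_right_mono) auto
  finally show "reciprocal_sum q S \<le> head S j + 2 / real (q j)"
    using split by simp
qed

text \<open>At the least index \<open>k\<close> where two sets differ, the term
  \<open>1 / q k\<close> of one outweighs the entire later tail of the other, at most
  \<open>2 / q (Suc k)\<close>.\<close>

lemma inj_reciprocal_sum: "inj (reciprocal_sum q)"
proof (rule injI, rule ccontr)
  fix S T assume eq: "reciprocal_sum q S = reciprocal_sum q T" and "S \<noteq> T"
  have less: "reciprocal_sum q T < reciprocal_sum q S"
    if k: "k \<in> S" "k \<notin> T" and agree: "\<And>i. i < k \<Longrightarrow> i \<in> S \<longleftrightarrow> i \<in> T" for S T k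
  proof -
    have heads: "(\<Sum>i<k. if i \<in> S then 1 / real (q i) else 0)
        = (\<Sum>i<k. if i \<in> T then 1 / real (q i) else 0)"
      using agree by (intro sum.cong) auto
    have "2 * real (q k) < real (q (Suc k))"
      using growth[of k] pos[of k] by linarith
    then have "2 / real (q (Suc k)) < 1 / real (q k)"
      using pos by (simp add: field_simps)
    then show ?thesis
      using reciprocal_sum_bounds(1)[of S "Suc k"] reciprocal_sum_bounds(2)[of T "Suc k"] heads k
      by simp
  qed
  define k where "k = (LEAST k. (k \<in> S) \<noteq> (k \<in> T))"
  have "\<exists>k. (k \<in> S) \<noteq> (k \<in> T)" using \<open>S \<noteq> T\<close> by blast
  then have k: "(k \<in> S) \<noteq> (k \<in> T)" unfolding k_def by (rule LeastI_ex)
  have "i \<in> S \<longleftrightarrow> i \<in> T" if "i < k" for i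
    using not_less_Least that unfolding k_def by blast
  then show False
    using less[of k S T] less[of k T S] k eq by auto
qed

lemma uncountable_range_reciprocal_sum: "uncountable (range (reciprocal_sum q))"
proof
  assume "countable (range (reciprocal_sum q))"
  then have "countable (UNIV :: nat set set)"
    using countable_image_inj_on inj_reciprocal_sum by blast
  then obtain f :: "nat \<Rightarrow> nat set" where "range f = UNIV"
    by (metis UNIV_not_empty range_from_nat_into)
  then show False
    using Cantors_theorem[of UNIV] by auto
qed

text \<open>By divisibility the partial sum through index \<open>j\<close> has denominator
  \<open>q j\<close>. Only the numerator depends on \<open>S\<close>, so all points of the Cantor
  set share the same denominators and error bounds.\<close>

lemma reciprocal_sum_approx:
  assumes dvd: "\<And>k. q k dvd q (Suc k)"
  shows "\<exists>p::int. \<bar>reciprocal_sum q S - of_int p / real (q j)\<bar> \<le> 2 / real (q (Suc j))"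
proof -
  have "q k dvd q j" if "k \<le> j" for k
    using that by (induction rule: dec_induct) (auto intro: dvd_trans dvd)
  then have term_eq: "1 / real (q k) = real (q j div q k) / real (q j)" if "k < Suc j" for k
    using that pos[of j] pos[of k] by (simp add: real_of_nat_div field_simps)
  define p where "p = (\<Sum>k<Suc j. if k \<in> S then q j div q k else 0)"
  have "(\<Sum>k<Suc j. if k \<in> S then 1 / real (q k) else 0)
      = (\<Sum>k<Suc j. real (if k \<in> S then q j div q k else 0) / real (q j))"
    by (intro sum.cong refl) (auto simp: term_eq)
  also have "\<dots> = of_int (int p) / real (q j)"
    unfolding p_def sum_divide_distrib[symmetric] by simp
  finally have "\<bar>reciprocal_sum q S - of_int (int p) / real (q j)\<bar> \<le> 2 / real (q (Suc j))"
    using reciprocal_sum_bounds(1)[of S "Suc j"] reciprocal_sum_bounds(2)[of S "Suc j"]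
    by linarith
  then show ?thesis ..
qed

end

section \<open>The denominators and the approximating function\<close>

text \<open>The factorial is large enough that its divisor sum, divided by it, is at least
  \<open>4 ^ j * denom j\<close>; this beats the loss of \<open>denom j\<close> in the radius. The
  factor \<open>8 * 2 ^ j\<close> keeps the neighbourhoods at stage \<open>j\<close> of size
  \<open>(1/2) ^ j\<close>, and its 8 gives the lacunarity.\<close>

primrec denom :: "nat \<Rightarrow> nat" where
  "denom 0 = 1"
| "denom (Suc j) = 8 * 2 ^ j * denom j * fact (4 ^ (4 ^ j * denom j))"

definition modulus :: "nat \<Rightarrow> nat" where
  "modulus j = fact (4 ^ (4 ^ j * denom j))"

lemma modulus_pos: "modulus j > 0"
  by (simp add: modulus_def)

lemma denom_Suc: "denom (Suc j) = 8 * 2 ^ j * (denom j * modulus j)"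
  by (simp add: modulus_def)

declare denom.simps(2)[simp del]

lemma denom_pos: "denom j > 0"
  by (induction j) (auto simp: denom_Suc modulus_pos)

lemma denom_growth: "8 * denom j \<le> denom (Suc j)"
proof -
  have "1 \<le> 2 ^ j * modulus j"
    using modulus_pos[of j] by (simp add: Suc_le_eq)
  then have "8 * denom j * 1 \<le> 8 * denom j * (2 ^ j * modulus j)"
    by (rule mult_left_mono) simp
  then show ?thesis by (simp add: denom_Suc mult_ac)
qed

lemma denom_dvd: "denom j dvd denom (Suc j)"
  by (simp add: denom_Suc)

lemma denom_mono: "i \<le> j \<Longrightarrow> denom i \<le> denom j"
proof (rule lift_Suc_mono_le[of denom])
  show "denom k \<le> denom (Suc k)" for k
    using denom_growth[of k] by linarith
qed

text \<open>Each \<open>n\<close> is served by the first stage whose modulus it divides. For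
  \<open>n = 0\<close> there is no such stage and the value is unspecified, but
  \<open>approx_fn 0\<close> is 0 anyway.\<close>

definition level :: "nat \<Rightarrow> nat" where
  "level n = (LEAST j. n dvd modulus j)"

text \<open>With \<open>j = level n\<close>, the factor after \<open>real n\<close> is \<epsilon>
  divided by \<open>denom j * modulus j\<close>, where \<epsilon> is half of
  \<open>(1/2) ^ j\<close>; the other half leaves room for the error in approximating
  \<open>y\<close>.\<close>

definition approx_fn :: "nat \<Rightarrow> real" where
  "approx_fn n = real n * (4 / real (denom (Suc (level n))))"

text \<open>Stage \<open>n\<close> itself has a factorial long enough to contain the factor
  \<open>n\<close>, so the least stage exists.\<close>

lemma dvd_modulus_level:
  assumes "n > 0"
  shows "n dvd modulus (level n)"
proof -
  have "n \<le> 4 ^ n"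
    by (rule less_imp_le[OF less_exp[THEN less_le_trans]]) (simp add: power_mono)
  also have "\<dots> \<le> 4 ^ (4 ^ n * denom n)"
  proof (rule power_increasing)
    have "n * 1 \<le> 4 ^ n * denom n"
      using \<open>n \<le> 4 ^ n\<close> denom_pos[of n] by (intro mult_mono) auto
    then show "n \<le> 4 ^ n * denom n" by simp
  qed simp
  finally have "n dvd modulus n"
    unfolding modulus_def using assms by (intro dvd_fact) auto
  then show ?thesis
    unfolding level_def by (rule LeastI)
qed

text \<open>The divisors of \<open>modulus j\<close> alone contribute at least
  \<open>2 ^ j / 2\<close> to this series of nonnegative terms, for every \<open>j\<close>.\<close>

lemma not_summable_approx_fn: "\<not> summable (\<lambda>n. approx_fn (Suc n))"
proof
  assume "summable (\<lambda>n. approx_fn (Suc n))"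
  then have summ: "summable approx_fn" by (simp only: summable_Suc_iff)
  have nonneg: "approx_fn n \<ge> 0" for n by (simp add: approx_fn_def)
  have "2 ^ j / 2 \<le> (\<Sum>n. approx_fn n)" for j
  proof -
    define D where "D = {n. n dvd modulus j}"
    define r where "r = 4 / real (denom (Suc j))"
    have fin: "finite D"
      unfolding D_def using modulus_pos by (intro finite_divisors_nat)
    have "real (modulus j) * real (4 ^ j * denom j) \<le> real (modulus j) * harm (4 ^ (4 ^ j * denom j))"
      by (intro mult_left_mono harm_power_4_ge) simp
    also have "\<dots> \<le> real (\<Sum>D)"
      using sum_divisors_fact_ge[of "4 ^ (4 ^ j * denom j)"]
      unfolding D_def modulus_def of_nat_fact .
    finally have "real (modulus j) * real (4 ^ j * denom j) * r \<le> real (\<Sum>D) * r"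
      by (rule mult_right_mono) (simp add: r_def)
    moreover have "real (modulus j) * real (4 ^ j * denom j) * r = 2 ^ j / 2"
    proof -
      have "(4::real) ^ j = 2 ^ j * 2 ^ j"
        by (simp flip: power_mult_distrib)
      then show ?thesis
        using modulus_pos[of j] denom_pos[of j] by (simp add: r_def denom_Suc field_simps)
    qed
    moreover have "real (\<Sum>D) * r = (\<Sum>n\<in>D. real n * r)"
      by (simp add: sum_distrib_right)
    \<comment> \<open>Divisors already served by an earlier stage only gain, since earlier radii are
      at least as large.\<close>
    moreover have "(\<Sum>n\<in>D. real n * r) \<le> (\<Sum>n\<in>D. approx_fn n)"
    proof (rule sum_mono)
      fix n assume "n \<in> D"
      then have "level n \<le> j"
        unfolding level_def D_def by (intro Least_le) auto
      then have "denom (Suc (level n)) \<le> denom (Suc j)"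
        by (intro denom_mono) simp
      then show "real n * r \<le> approx_fn n"
        unfolding approx_fn_def r_def using denom_pos
        by (intro mult_left_mono divide_left_mono) auto
    qed
    moreover have "(\<Sum>n\<in>D. approx_fn n) \<le> (\<Sum>n. approx_fn n)"
      using summ fin nonneg by (intro sum_le_suminf) auto
    ultimately show ?thesis by linarith
  qed
  then have "2 ^ j \<le> 2 * (\<Sum>n. approx_fn n)" for j
    by (simp add: field_simps)
  then show False
    using real_arch_pow[of 2 "2 * (\<Sum>n. approx_fn n)"] by (auto simp: not_less[symmetric])
qed

section \<open>Nullity for every point of the Cantor set\<close>

text \<open>A solution \<open>n\<close> puts \<open>x\<close> into \<open>F (level n)\<close>. Each
  level holds only finitely many \<open>n\<close>, being divisors of one positive modulus, so
  infinitely many solutions put \<open>x\<close> into infinitely many \<open>F j\<close>.\<close>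

lemma null_sets_limsup_approx:
  assumes "y \<in> range (reciprocal_sum denom)"
  shows "{x. infinite {n. n \<ge> 1 \<and> dist_nearest_int (real n * x + y) < approx_fn n}}
    \<in> null_sets lebesgue"
proof -
  define F where "F j = near_fractions (denom j * modulus j) ((1 / 2) ^ j)" for j
  have null: "limsup F \<in> null_sets lebesgue"
    unfolding F_def
    by (rule null_sets_limsup_near_fractions)
       (auto simp: denom_pos modulus_pos power_le_one intro: summable_geometric)
  have mem: "x \<in> F (level n)"
    if n: "n \<ge> 1" and x: "dist_nearest_int (real n * x + y) < approx_fn n" for n x
  proof -
    define j where "j = level n"
    obtain p :: int where p: "\<bar>y - of_int p / real (denom j)\<bar> \<le> 2 / real (denom (Suc j))"
      using assms reciprocal_sum_approx[of denom, OF denom_pos denom_growth denom_dvd] by blast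
    \<comment> \<open>The 4 is the radius in \<open>approx_fn\<close>, the 2 the error for
      \<open>y\<close>; their sum stays below the 8 in \<open>denom\<close>.\<close>
    have "real (denom j * modulus j) * (4 / real (denom (Suc j)) + 2 / real (denom (Suc j)))
        = (6 / 8) * (1 / 2) ^ j"
      using denom_pos[of j] modulus_pos[of j] by (simp add: denom_Suc field_simps)
    also have "\<dots> \<le> (1 / 2) ^ j" by simp
    finally show ?thesis
      unfolding F_def j_def[symmetric]
      by (intro mem_near_fractions_if_approx[OF _ modulus_pos denom_pos p,
            where r = "4 / real (denom (Suc j))"])
         (use n x dvd_modulus_level[of n] in \<open>simp_all add: approx_fn_def j_def\<close>)
  qed
  have "{x. infinite {n. n \<ge> 1 \<and> dist_nearest_int (real n * x + y) < approx_fn n}} \<subseteq> limsup F"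
  proof
    fix x assume "x \<in> {x. infinite {n. n \<ge> 1 \<and> dist_nearest_int (real n * x + y) < approx_fn n}}"
    then have inf: "infinite {n. n \<ge> 1 \<and> dist_nearest_int (real n * x + y) < approx_fn n}"
      (is "infinite ?I")
      by (rule CollectD)
    have "\<exists>j\<ge>i. x \<in> F j" for i
    proof (rule ccontr)
      assume none: "\<not> (\<exists>j\<ge>i. x \<in> F j)"
      have "?I \<subseteq> (\<Union>j<i. {n. n dvd modulus j})"
      proof
        fix n assume "n \<in> ?I"
        then have n: "n \<ge> 1" "dist_nearest_int (real n * x + y) < approx_fn n"
          by simp_all
        have "level n < i"
          using mem[OF n] none not_less by blast
        moreover have "n dvd modulus (level n)"
          using n(1) by (intro dvd_modulus_level) simp
        ultimately show "n \<in> (\<Union>j<i. {n. n dvd modulus j})"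
          by blast
      qed
      moreover have "finite (\<Union>j<i. {n. n dvd modulus j})"
        by (intro finite_UN_I finite_divisors_nat modulus_pos finite_lessThan)
      ultimately have "finite ?I"
        by (rule finite_subset)
      with inf show False
        by (rule notE)
    qed
    then show "x \<in> limsup F"
      by (simp add: limsup_INF_SUP Bex_def)
  qed
  \<comment> \<open>Completeness of Lebesgue measure also yields the measurability of the
    subset.\<close>
  then show ?thesis
    using null by (rule null_sets_completion_subset)
qed

theorem theorem1p3:
  shows "\<exists>(C :: real set) (\<psi> :: nat \<Rightarrow> real).
    uncountable C \<and>
    (\<forall>n\<ge>1. 0 \<le> \<psi> n) \<and>
    \<not> summable (\<lambda>n. \<psi> (Suc n)) \<and>
    (\<forall>y\<in>C. {x :: real. infinite {n :: nat. n \<ge> 1 \<and> dist_nearest_int (real n * x + y) < \<psi> n}}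
              \<in> null_sets lebesgue)"
proof (intro exI conjI)
  show "uncountable (range (reciprocal_sum denom))"
    by (rule uncountable_range_reciprocal_sum[of denom, OF denom_pos denom_growth])
  show "\<forall>n\<ge>1. 0 \<le> approx_fn n"
    by (simp add: approx_fn_def)
  show "\<not> summable (\<lambda>n. approx_fn (Suc n))"
    by (rule not_summable_approx_fn)
qed (intro ballI null_sets_limsup_approx)

end
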